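(* Let $\lambda\in\mathbb{K}$, let $(A,\mu,R,d)$ be a modified Rota-Baxter LieDer pair of weight $\lambda$, and let $(\mu_t,R_t,d_t)$ be a one-parameter formal deformation of it, with $\mu_t=\sum_{i\ge0}\mu_it^i$, $R_t=\sum_{i\ge0}R_it^i$, $d_t=\sum_{i\ge0}d_it^i$. Then $(\mu_1,R_1,d_1)$ is a $2$-cocycle in the cochain complex $\big(\mathfrak{C}^\star_{\mathrm{mRBLD}^\lambda}(A,A),\mathfrak{D}^\star_{\mathrm{mRBLD}^\lambda}\big)$, i.e. $\mathfrak{D}^2_{\mathrm{mRBLD}^\lambda}\big((\mu_1,R_1),(d_1,0)\big)=0$.
   Context: $\mathbb{K}$ is a field of characteristic $0$. A modified Rota-Baxter LieDer pair of weight $\lambda$ is $(A,\mu,R,d)$ where $(A,\mu)$ is a Lie algebra with bracket $\mu=[-,-]$, $R:A\to A$ is linear with $[Ra,Rb]=R([Ra,b]+[a,Rb])+\lambda[a,b]$ for all $a,b\in A$, and $d$ is a derivation of $(A,\mu)$ with $R\circ d=d\circ R$. (The same definition is used over $\mathbb{K}[\![t]\!]$.) A one-parameter formal deformation of $(A,\mu,R,d)$ is a triple of power series $\mu_t=\sum_{i\ge0}\mu_it^i$ with $\mu_i\in\mathrm{Hom}(\wedge^2A,A)$, $R_t=\sum_{i\ge0}R_it^i$ and $d_t=\sum_{i\ge0}d_it^i$ with $R_i,d_i\in\mathrm{Hom}(A,A)$, such that $(\mu_0,R_0,d_0)=(\mu,R,d)$ and $(A[\![t]\!],\mu_t,R_t,d_t)$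 (with the maps extended $\mathbb{K}[\![t]\!]$-linearly) is a modified Rota-Baxter LieDer pair of weight $\lambda$ over $\mathbb{K}[\![t]\!]$. Degree-2 part of the complex with coefficients in the adjoint representation: let $[a,b]_R=[Ra,b]+[a,Rb]$ and $\rho_R(a)b=[Ra,b]-R[a,b]$. Then $\mathfrak{C}^2_{\mathrm{mRBLD}^\lambda}(A,A)=\big(\mathrm{Hom}(\wedge^2A,A)\oplus\mathrm{Hom}(A,A)\big)\times\big(\mathrm{Hom}(A,A)\oplus A\big)$, a triple $(f,g,h)$ with $f\in\mathrm{Hom}(\wedge^2A,A)$ and $g,h\in\mathrm{Hom}(A,A)$ is regarded as the element $((f,g),(h,0))$, and $$\mathfrak{D}^2_{\mathrm{mRBLD}^\lambda}((f,g),(h,s))=\Big(\big(\delta^2_{\mathrm{CE}}f,\,-\delta^1_{\mathrm{mRBO}^\lambda}g-\phi^2f\big),\ \big(\delta^1_{\mathrm{CE}}h+\Delta^2f,\,-\delta^0_{\mathrm{mRBO}^\lambda}s-\phi^1h+\Delta^1g\big)\Big),$$ where $\delta^2_{\mathrm{CE}}f(a,b,c)=-[a,f(b,c)]+[b,f(a,c)]-[c,f(a,b)]+f([a,b],c)-f([a,c],b)+f([b,c],a)$; $\delta^1_{\mathrm{CE}}h(a,b)=[a,h(b)]-[b,h(a)]-h([a,b])$; $\delta^1_{\mathrm{mRBO}^\lambda}g(a,b)=\rho_R(a)g(b)-\rho_R(b)g(a)-g([a,b]_R)$; $\delta^0_{\mathrm{mRBO}^\lambda}s(a)=-\rho_R(a)s$;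 $\phi^1h(a)=h(Ra)-R(h(a))$; $\phi^2f(a,b)=f(Ra,Rb)-R(f(Ra,b))-R(f(a,Rb))-\lambda f(a,b)$; $\Delta^1g(a)=g(da)-d(g(a))$; $\Delta^2f(a,b)=f(da,b)+f(a,db)-d(f(a,b))$. *)

theory Defs
  imports "HOL-Computational_Algebra.Formal_Power_Series"
begin

(* All structures are over an arbitrary commutative ring, so that the same definitions apply
   to a vector space A over a field K and to the K[[t]]-module A[[t]]. *)

context module
begin

definition End :: "('b \<Rightarrow> 'b) set" where
  "End = {f. module_hom scale scale f}"

(* Hom(Wedge^2 A, A), as the alternating bilinear maps. *)
definition Alt2 :: "('b \<Rightarrow> 'b \<Rightarrow> 'b) set" where
  "Alt2 = {f. (\<forall>a. module_hom scale scale (f a)) \<and>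
              (\<forall>b. module_hom scale scale (\<lambda>a. f a b)) \<and>
              (\<forall>a. f a a = 0)}"

end

locale lie_algebra = module scale
  for scale :: "'k::comm_ring_1 \<Rightarrow> 'a::ab_group_add \<Rightarrow> 'a" +
  fixes bracket :: "'a \<Rightarrow> 'a \<Rightarrow> 'a"
  assumes bracket_Alt2: "bracket \<in> Alt2"
    and jacobi: "bracket a (bracket b c) + bracket b (bracket c a) + bracket c (bracket a b) = 0"
begin

definition derivation :: "('a \<Rightarrow> 'a) \<Rightarrow> bool" where
  "derivation d \<longleftrightarrow> d \<in> End \<and>
     (\<forall>a b. d (bracket a b) = bracket (d a) b + bracket a (d b))"

end

locale mRB_LieDer_pair = lie_algebra scale bracket
  for scale :: "'k::comm_ring_1 \<Rightarrow> 'a::ab_group_add \<Rightarrow> 'a"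
    and lam :: 'k
    and bracket :: "'a \<Rightarrow> 'a \<Rightarrow> 'a"
    and R :: "'a \<Rightarrow> 'a"
    and d :: "'a \<Rightarrow> 'a" +
  assumes R_linear: "R \<in> End"
    and modified_Rota_Baxter:
      "bracket (R a) (R b) = R (bracket (R a) b + bracket a (R b)) + scale lam (bracket a b)"
    and d_derivation: "derivation d"
    and R_d_commute: "R \<circ> d = d \<circ> R"

(* A[[t]] is the type 'a fps; only its additive structure and the following K[[t]]-action
   are used. *)
definition fps_scale ::
    "('k::comm_ring_1 \<Rightarrow> 'a::ab_group_add \<Rightarrow> 'a) \<Rightarrow> 'k fps \<Rightarrow> 'a fps \<Rightarrow> 'a fps" where
  "fps_scale scale c x =
     Abs_fps (\<lambda>n. \<Sum>i\<le>n. scale (fps_nth c i) (fps_nth x (n - i)))"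

(* The K[[t]]-linear extensions to A[[t]] of the series sum_i f_i t^i of linear maps
   (fps_extend1) and of bilinear maps (fps_extend2). *)
definition fps_extend1 ::
    "(nat \<Rightarrow> 'a::ab_group_add \<Rightarrow> 'a) \<Rightarrow> 'a fps \<Rightarrow> 'a fps" where
  "fps_extend1 f x = Abs_fps (\<lambda>n. \<Sum>i\<le>n. f i (fps_nth x (n - i)))"

definition fps_extend2 ::
    "(nat \<Rightarrow> 'a::ab_group_add \<Rightarrow> 'a \<Rightarrow> 'a) \<Rightarrow> 'a fps \<Rightarrow> 'a fps \<Rightarrow> 'a fps" where
  "fps_extend2 f x y =
     Abs_fps (\<lambda>n. \<Sum>i\<le>n. \<Sum>j\<le>n - i. f i (fps_nth x j) (fps_nth y (n - i - j)))"

context mRB_LieDer_pair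
begin

definition formal_deformation ::
    "(nat \<Rightarrow> 'a \<Rightarrow> 'a \<Rightarrow> 'a) \<Rightarrow> (nat \<Rightarrow> 'a \<Rightarrow> 'a) \<Rightarrow> (nat \<Rightarrow> 'a \<Rightarrow> 'a) \<Rightarrow> bool" where
  "formal_deformation \<mu>s Rs ds \<longleftrightarrow>
     (\<forall>i. \<mu>s i \<in> Alt2 \<and> Rs i \<in> End \<and> ds i \<in> End) \<and>
     \<mu>s 0 = bracket \<and> Rs 0 = R \<and> ds 0 = d \<and>
     mRB_LieDer_pair (fps_scale scale) (fps_const lam)
       (fps_extend2 \<mu>s) (fps_extend1 Rs) (fps_extend1 ds)"

definition bracket_R :: "'a \<Rightarrow> 'a \<Rightarrow> 'a" where
  "bracket_R a b = bracket (R a) b + bracket a (R b)"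

definition rho_R :: "'a \<Rightarrow> 'a \<Rightarrow> 'a" where
  "rho_R a b = bracket (R a) b - R (bracket a b)"

definition delta2_CE :: "('a \<Rightarrow> 'a \<Rightarrow> 'a) \<Rightarrow> 'a \<Rightarrow> 'a \<Rightarrow> 'a \<Rightarrow> 'a" where
  "delta2_CE f a b c =
     - bracket a (f b c) + bracket b (f a c) - bracket c (f a b)
     + f (bracket a b) c - f (bracket a c) b + f (bracket b c) a"

definition delta1_CE :: "('a \<Rightarrow> 'a) \<Rightarrow> 'a \<Rightarrow> 'a \<Rightarrow> 'a" where
  "delta1_CE h a b = bracket a (h b) - bracket b (h a) - h (bracket a b)"

definition delta1_mRBO :: "('a \<Rightarrow> 'a) \<Rightarrow> 'a \<Rightarrow> 'a \<Rightarrow> 'a" where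
  "delta1_mRBO g a b = rho_R a (g b) - rho_R b (g a) - g (bracket_R a b)"

definition delta0_mRBO :: "'a \<Rightarrow> 'a \<Rightarrow> 'a" where
  "delta0_mRBO s a = - rho_R a s"

definition phi1 :: "('a \<Rightarrow> 'a) \<Rightarrow> 'a \<Rightarrow> 'a" where
  "phi1 h a = h (R a) - R (h a)"

definition phi2 :: "('a \<Rightarrow> 'a \<Rightarrow> 'a) \<Rightarrow> 'a \<Rightarrow> 'a \<Rightarrow> 'a" where
  "phi2 f a b = f (R a) (R b) - R (f (R a) b) - R (f a (R b)) - scale lam (f a b)"

definition Delta1 :: "('a \<Rightarrow> 'a) \<Rightarrow> 'a \<Rightarrow> 'a" where
  "Delta1 g a = g (d a) - d (g a)"

definition Delta2 :: "('a \<Rightarrow> 'a \<Rightarrow> 'a) \<Rightarrow> 'a \<Rightarrow> 'a \<Rightarrow> 'a" where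
  "Delta2 f a b = f (d a) b + f a (d b) - d (f a b)"

definition C2_mRBLD :: "((('a \<Rightarrow> 'a \<Rightarrow> 'a) \<times> ('a \<Rightarrow> 'a)) \<times> (('a \<Rightarrow> 'a) \<times> 'a)) set" where
  "C2_mRBLD = (Alt2 \<times> End) \<times> (End \<times> UNIV)"

definition D2_mRBLD ::
    "(('a \<Rightarrow> 'a \<Rightarrow> 'a) \<times> ('a \<Rightarrow> 'a)) \<times> (('a \<Rightarrow> 'a) \<times> 'a) \<Rightarrow>
     (('a \<Rightarrow> 'a \<Rightarrow> 'a \<Rightarrow> 'a) \<times> ('a \<Rightarrow> 'a \<Rightarrow> 'a)) \<times> (('a \<Rightarrow> 'a \<Rightarrow> 'a) \<times> ('a \<Rightarrow> 'a))" where
  "D2_mRBLD = (\<lambda>((f, g), (h, s)).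
     ((\<lambda>a b c. delta2_CE f a b c,
       \<lambda>a b. - delta1_mRBO g a b - phi2 f a b),
      (\<lambda>a b. delta1_CE h a b + Delta2 f a b,
       \<lambda>a. - delta0_mRBO s a - phi1 h a + Delta1 g a)))"

definition two_cocycle ::
    "(('a \<Rightarrow> 'a \<Rightarrow> 'a) \<times> ('a \<Rightarrow> 'a)) \<times> (('a \<Rightarrow> 'a) \<times> 'a) \<Rightarrow> bool" where
  "two_cocycle x \<longleftrightarrow> x \<in> C2_mRBLD \<and>
     D2_mRBLD x = ((\<lambda>a b c. 0, \<lambda>a b. 0), (\<lambda>a b. 0, \<lambda>a. 0))"

end

end

theory Submission
  imports Defs
begin

text \<open>
  The cocycle condition is the linearisation of the axioms. Each axiom of a modified Rota-Baxter
  LieDer pair over \<open>K[[t]]\<close> (Jacobi, modified Rota-Baxter, Leibniz, commutation of \<open>R\<close> with \<open>d\<close>)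
  is evaluated at constant series. Its \<open>t\<^sup>1\<close>-coefficient is then the sum of
  all terms in which exactly one structure map is replaced by its first-order part
  (\<open>jacobi_order_1\<close>, \<open>modified_Rota_Baxter_order_1\<close>, \<open>derivation_order_1\<close>, \<open>commute_order_1\<close>).
  After antisymmetry is used to reorder arguments, these four identities say that the four
  components of the differential of \<open>((\<mu>\<^sub>1, R\<^sub>1), (d\<^sub>1, 0))\<close> vanish.
\<close>

context module
begin

lemma End_zero: "f \<in> End \<Longrightarrow> f 0 = 0"
  unfolding End_def by (auto intro: module_hom.zero)

lemma End_add: "f \<in> End \<Longrightarrow> f (x + y) = f x + f y"
  unfolding End_def by (auto intro: module_hom.add)

lemma End_minus: "f \<in> End \<Longrightarrow> f (- x) = - f x"
  unfolding End_def by (auto intro: module_hom.neg)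

lemma Alt2_End:
  assumes "f \<in> Alt2"
  shows "f a \<in> End" "(\<lambda>a. f a b) \<in> End"
  using assms unfolding Alt2_def End_def by auto

lemma Alt2_zero:
  assumes "f \<in> Alt2"
  shows "f a 0 = 0" "f 0 b = 0"
  using Alt2_End[OF assms, THEN End_zero] by auto

lemma Alt2_antisym:
  assumes "f \<in> Alt2"
  shows "f a b = - f b a"
proof -
  have "0 = f (a + b) (a + b)"
    using assms by (simp add: Alt2_def)
  also have "\<dots> = f a a + f a b + (f b a + f b b)"
    using End_add[OF Alt2_End(1)[OF assms]] End_add[OF Alt2_End(2)[OF assms]]
    by (simp add: add.commute add.left_commute)
  also have "\<dots> = f a b + f b a"
    using assms by (simp add: Alt2_def)
  finally show ?thesis
    by (simp add: eq_neg_iff_add_eq_0)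
qed

lemma fps_scale_const_nth: "fps_nth (fps_scale scale (fps_const c) x) n = scale c (fps_nth x n)"
proof -
  have "(\<Sum>i\<le>n. scale (fps_nth (fps_const c) i) (fps_nth x (n - i))) =
        (\<Sum>i\<in>{0}. scale (fps_nth (fps_const c) i) (fps_nth x (n - i)))"
    by (rule sum.mono_neutral_right) auto
  then show ?thesis
    by (simp add: fps_scale_def)
qed

end

lemma fps_extend1_nth_0: "fps_nth (fps_extend1 f x) 0 = f 0 (fps_nth x 0)"
  by (simp add: fps_extend1_def)

lemma fps_extend1_nth_1:
  "fps_nth (fps_extend1 f x) 1 = f 0 (fps_nth x 1) + f 1 (fps_nth x 0)"
  by (simp add: fps_extend1_def)

lemma fps_extend2_nth_0: "fps_nth (fps_extend2 f x y) 0 = f 0 (fps_nth x 0) (fps_nth y 0)"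
  by (simp add: fps_extend2_def)

lemma fps_extend2_nth_1:
  "fps_nth (fps_extend2 f x y) 1 =
     f 0 (fps_nth x 0) (fps_nth y 1) + f 0 (fps_nth x 1) (fps_nth y 0) +
     f 1 (fps_nth x 0) (fps_nth y 0)"
  by (simp add: fps_extend2_def)

lemmas fps_extend_nth =
  fps_extend1_nth_0 fps_extend1_nth_1 fps_extend2_nth_0 fps_extend2_nth_1

context mRB_LieDer_pair
begin

context
  fixes \<mu>s :: "nat \<Rightarrow> 'a \<Rightarrow> 'a \<Rightarrow> 'a" and Rs ds :: "nat \<Rightarrow> 'a \<Rightarrow> 'a"
  assumes deformation: "formal_deformation \<mu>s Rs ds"
begin

lemma \<mu>s_Alt2: "\<mu>s i \<in> Alt2"
  and Rs_End: "Rs i \<in> End"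
  and ds_End: "ds i \<in> End"
  and order_0: "\<mu>s 0 = bracket" "Rs 0 = R" "ds 0 = d"
  and deformed_pair: "mRB_LieDer_pair (fps_scale scale) (fps_const lam)
    (fps_extend2 \<mu>s) (fps_extend1 Rs) (fps_extend1 ds)"
  using deformation unfolding formal_deformation_def by auto

lemmas order_1_simps =
  fps_extend_nth fps_scale_const_nth order_0
  End_zero[OF R_linear] End_zero[OF ds_End[of 0, unfolded order_0]] Alt2_zero[OF bracket_Alt2]

text \<open>
  At constant series every term in which a leading-order map is applied to a vanishing
  coefficient drops out by linearity, so the \<open>t\<^sup>1\<close>-coefficients of the deformed axioms involve
  only the original maps and their first-order parts.
\<close>

lemma jacobi_order_1:
  "bracket a (\<mu>s 1 b c) + bracket b (\<mu>s 1 c a) + bracket c (\<mu>s 1 a b) +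
   \<mu>s 1 a (bracket b c) + \<mu>s 1 b (bracket c a) + \<mu>s 1 c (bracket a b) = 0"
proof -
  interpret T: mRB_LieDer_pair "fps_scale scale" "fps_const lam"
    "fps_extend2 \<mu>s" "fps_extend1 Rs" "fps_extend1 ds"
    by (rule deformed_pair)
  show ?thesis
    using arg_cong[OF T.jacobi[of "fps_const a" "fps_const b" "fps_const c"],
        of "\<lambda>x. fps_nth x 1"]
    by (simp add: order_1_simps add_ac del: One_nat_def)
qed

lemma modified_Rota_Baxter_order_1:
  "bracket (R a) (Rs 1 b) + bracket (Rs 1 a) (R b) + \<mu>s 1 (R a) (R b) =
   R (bracket (Rs 1 a) b + \<mu>s 1 (R a) b + (bracket a (Rs 1 b) + \<mu>s 1 a (R b))) +
   Rs 1 (bracket (R a) b + bracket a (R b)) + scale lam (\<mu>s 1 a b)"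
proof -
  interpret T: mRB_LieDer_pair "fps_scale scale" "fps_const lam"
    "fps_extend2 \<mu>s" "fps_extend1 Rs" "fps_extend1 ds"
    by (rule deformed_pair)
  show ?thesis
    using arg_cong[OF T.modified_Rota_Baxter[of "fps_const a" "fps_const b"],
        of "\<lambda>x. fps_nth x 1"]
    by (simp add: order_1_simps del: One_nat_def)
qed

lemma derivation_order_1:
  "d (\<mu>s 1 a b) + ds 1 (bracket a b) =
   bracket (ds 1 a) b + \<mu>s 1 (d a) b + (bracket a (ds 1 b) + \<mu>s 1 a (d b))"
proof -
  interpret T: mRB_LieDer_pair "fps_scale scale" "fps_const lam"
    "fps_extend2 \<mu>s" "fps_extend1 Rs" "fps_extend1 ds"
    by (rule deformed_pair)
  have "fps_extend1 ds (fps_extend2 \<mu>s (fps_const a) (fps_const b)) =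
      fps_extend2 \<mu>s (fps_extend1 ds (fps_const a)) (fps_const b) +
      fps_extend2 \<mu>s (fps_const a) (fps_extend1 ds (fps_const b))"
    using T.d_derivation unfolding T.derivation_def by blast
  from arg_cong[OF this, of "\<lambda>x. fps_nth x 1"] show ?thesis
    by (simp add: order_1_simps del: One_nat_def)
qed

lemma commute_order_1: "R (ds 1 a) + Rs 1 (d a) = d (Rs 1 a) + ds 1 (R a)"
proof -
  interpret T: mRB_LieDer_pair "fps_scale scale" "fps_const lam"
    "fps_extend2 \<mu>s" "fps_extend1 Rs" "fps_extend1 ds"
    by (rule deformed_pair)
  show ?thesis
    using arg_cong[OF fun_cong[OF T.R_d_commute, of "fps_const a"], of "\<lambda>x. fps_nth x 1"]
    by (simp add: order_1_simps del: One_nat_def)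
qed

text \<open>
  The Jacobi identity is written cyclically and the coboundary with ordered arguments.
  Antisymmetry of both brackets matches the two, up to a global sign.
\<close>

lemma delta2_CE_infinitesimal: "delta2_CE (\<mu>s 1) a b c = 0"
proof -
  note swap = Alt2_antisym[OF \<mu>s_Alt2, of 1]
  have "bracket b (\<mu>s 1 a c) = - bracket b (\<mu>s 1 c a)"
    using swap[of a c] by (simp add: End_minus[OF Alt2_End(1)[OF bracket_Alt2]])
  moreover have "\<mu>s 1 (bracket a c) b = \<mu>s 1 b (bracket c a)"
    using swap[of "bracket a c" b] Alt2_antisym[OF bracket_Alt2, of a c]
    by (simp add: End_minus[OF Alt2_End(1)[OF \<mu>s_Alt2]])
  ultimately have "delta2_CE (\<mu>s 1) a b c =
    - (bracket a (\<mu>s 1 b c) + bracket b (\<mu>s 1 c a) + bracket c (\<mu>s 1 a b) +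
       \<mu>s 1 a (bracket b c) + \<mu>s 1 b (bracket c a) + \<mu>s 1 c (bracket a b))"
    using swap[of "bracket a b" c] swap[of "bracket b c" a]
    by (simp add: delta2_CE_def algebra_simps)
  then show ?thesis
    by (simp only: jacobi_order_1 minus_zero)
qed

text \<open>
  The terms of the linearised modified Rota-Baxter identity that contain \<open>\<mu>\<^sub>1\<close>
  make up \<open>phi2\<close>. Those that contain \<open>R\<^sub>1\<close> make up \<open>delta1_mRBO\<close>, once \<open>rho_R b (R\<^sub>1 a)\<close>
  is reordered by antisymmetry.
\<close>

lemma delta1_mRBO_infinitesimal: "- delta1_mRBO (Rs 1) a b - phi2 (\<mu>s 1) a b = 0"
proof -
  note swap = Alt2_antisym[OF bracket_Alt2]
  have "rho_R b (Rs 1 a) = - bracket (Rs 1 a) (R b) + R (bracket (Rs 1 a) b)"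
    using swap[of "R b" "Rs 1 a"] swap[of b "Rs 1 a"]
    by (simp add: rho_R_def End_minus[OF R_linear])
  then have "- delta1_mRBO (Rs 1) a b - phi2 (\<mu>s 1) a b =
    R (bracket (Rs 1 a) b + \<mu>s 1 (R a) b + (bracket a (Rs 1 b) + \<mu>s 1 a (R b))) +
    Rs 1 (bracket (R a) b + bracket a (R b)) + scale lam (\<mu>s 1 a b) -
    (bracket (R a) (Rs 1 b) + bracket (Rs 1 a) (R b) + \<mu>s 1 (R a) (R b))"
    by (simp add: delta1_mRBO_def phi2_def bracket_R_def rho_R_def[of a] End_add[OF R_linear]
        algebra_simps del: One_nat_def)
  then show ?thesis
    by (simp only: modified_Rota_Baxter_order_1 diff_self)
qed

lemma delta1_CE_infinitesimal: "delta1_CE (ds 1) a b + Delta2 (\<mu>s 1) a b = 0"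
  using derivation_order_1[of a b] Alt2_antisym[OF bracket_Alt2, of b "ds 1 a"]
  by (simp add: delta1_CE_def Delta2_def algebra_simps)

lemma Delta1_infinitesimal: "- delta0_mRBO 0 a - phi1 (ds 1) a + Delta1 (Rs 1) a = 0"
  using commute_order_1[of a]
  by (simp add: delta0_mRBO_def rho_R_def phi1_def Delta1_def Alt2_zero[OF bracket_Alt2]
      End_zero[OF R_linear] algebra_simps)

lemma two_cocycle_infinitesimal: "two_cocycle ((\<mu>s 1, Rs 1), (ds 1, 0))"
  unfolding two_cocycle_def C2_mRBLD_def D2_mRBLD_def
  by (simp add: fun_eq_iff \<mu>s_Alt2 Rs_End ds_End delta1_CE_infinitesimal Delta1_infinitesimal
      delta2_CE_infinitesimal delta1_mRBO_infinitesimal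
      del: One_nat_def)

end

end

theorem theorem4p2:
  fixes scale :: "'k::field_char_0 \<Rightarrow> 'a::ab_group_add \<Rightarrow> 'a"
    and lam :: 'k
    and \<mu> :: "'a \<Rightarrow> 'a \<Rightarrow> 'a"
    and R d :: "'a \<Rightarrow> 'a"
    and \<mu>s :: "nat \<Rightarrow> 'a \<Rightarrow> 'a \<Rightarrow> 'a"
    and Rs ds :: "nat \<Rightarrow> 'a \<Rightarrow> 'a"
  assumes "mRB_LieDer_pair scale lam \<mu> R d"
    and "mRB_LieDer_pair.formal_deformation scale lam \<mu> R d \<mu>s Rs ds"
  shows "mRB_LieDer_pair.two_cocycle scale lam \<mu> R d ((\<mu>s 1, Rs 1), (ds 1, 0))"
  using assms by (rule mRB_LieDer_pair.two_cocycle_infinitesimal)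

end
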